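(* Let $F_1,F_2,F_3\in\mathcal{S}_1$ define the vertices of a proper spherical triangle; let $\mathsf{a}_1,\mathsf{a}_2,\mathsf{a}_3$ be the normalized vectors corresponding to $F_1,F_2,F_3$, let $a_i=(\mathsf{a}_i,-\mathsf{a}_i)$ be the corresponding pairs of antipodal points on the sphere, and let $\alpha_1,\alpha_2,\alpha_3$ be their dual great circles. Then the Jacobi identity $$\{\{F_1,F_2\},F_3\}+\{\{F_2,F_3\},F_1\}+\{\{F_3,F_1\},F_2\}=0$$ has the following geometrical meaning: (i) the altitudes of the eight spherical triangles with vertices $\pm\mathsf{a}_1,\pm\mathsf{a}_2,\pm\mathsf{a}_3$ all meet at the same pair $(\mathsf{h},-\mathsf{h})$ of antipodal points; (ii) these altitudes are also the altitudes of the eight spherical triangles defined by the three great circles $\alpha_1,\alpha_2,\alpha_3$.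
   Context: $\mathcal{S}_1=\{Xf_1+Yf_2+Zf_3:(X,Y,Z)\in\mathbb{R}^3\}$ where $f_1=\sin\theta\cos\phi$, $f_2=\sin\theta\sin\phi$, $f_3=\cos\theta$ are functions on the unit sphere $S^2\subset\mathbb{R}^3$ (with $x=\sin\theta\cos\phi$, $y=\sin\theta\sin\phi$, $z=\cos\theta$). The Poisson bracket is $\{F,F'\}=\frac{1}{\sin\theta}\left(\frac{\partial F}{\partial\theta}\frac{\partial F'}{\partial\phi}-\frac{\partial F}{\partial\phi}\frac{\partial F'}{\partial\theta}\right)$, which maps $\mathcal{S}_1\times\mathcal{S}_1$ to $\mathcal{S}_1$. The normalized vector corresponding to $F=Xf_1+Yf_2+Zf_3\neq0$ is $(X,Y,Z)/\sqrt{X^2+Y^2+Z^2}\in S^2$. Three points of $S^2$ are the vertices of a spherical triangle if they are linearly independent as vectors of $\mathbb{R}^3$; its sides lie on the great circles through pairs of vertices. Three great circles without common point define eight spherical triangles: those cut off by them, obtained by choosing one vertex in each of the three pairs of antipodal points in which two of the circles intersect. A pair of antipodal points and a great circle are dual to each other if the great circle is equidistant from the two points. A spherical triangle is proper if none of its vertices belongs to the pair of antipodal points dual to the great circle containing the other two vertices. The altitude from a vertex of a proper spherical triangle is the great circle through that vertex intersecting orthogonally the great circle containing the opposite side. "Has the geometrical meaning" is to be read as: the listed geometrical statements hold (as consequences of the Jacobi identity). *)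

theory Defs
  imports "HOL-Analysis.Analysis"
begin

abbreviation S2 :: "(real^3) set" where
  "S2 \<equiv> sphere 0 1"

section \<open>Functions on the sphere and the Poisson bracket\<close>

text \<open>
  A function on the sphere is a function on \<open>real^3\<close> of which only the values on \<open>S2\<close>
  matter; two such functions are equal if they agree on \<open>S2\<close>.
\<close>

definition sph :: "real \<Rightarrow> real \<Rightarrow> real^3" where
  "sph \<theta> \<phi> = vector [sin \<theta> * cos \<phi>, sin \<theta> * sin \<phi>, cos \<theta>]"

definition colat :: "real^3 \<Rightarrow> real" where
  "colat p = arccos (p $ 3)"

text \<open>At the two poles, where the longitude is not determined, \<open>lon\<close> is \<open>Arg 0 = 0\<close>.\<close>

definition lon :: "real^3 \<Rightarrow> real" where
  "lon p = Arg (Complex (p $ 1) (p $ 2))"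

definition f1 :: "real^3 \<Rightarrow> real" where
  "f1 p = sin (colat p) * cos (lon p)"

definition f2 :: "real^3 \<Rightarrow> real" where
  "f2 p = sin (colat p) * sin (lon p)"

definition f3 :: "real^3 \<Rightarrow> real" where
  "f3 p = cos (colat p)"

definition lin_comb :: "real^3 \<Rightarrow> real^3 \<Rightarrow> real" where
  "lin_comb v p = v $ 1 * f1 p + v $ 2 * f2 p + v $ 3 * f3 p"

definition S1 :: "(real^3 \<Rightarrow> real) set" where
  "S1 = {F. \<exists>v. \<forall>p\<in>S2. F p = lin_comb v p}"

definition normalized :: "(real^3 \<Rightarrow> real) \<Rightarrow> real^3" where
  "normalized F = (let v = (THE v. \<forall>p\<in>S2. F p = lin_comb v p) in v /\<^sub>R norm v)"

definition chart_bracket ::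
  "(real^3 \<Rightarrow> real) \<Rightarrow> (real^3 \<Rightarrow> real) \<Rightarrow> real \<Rightarrow> real \<Rightarrow> real" where
  "chart_bracket F G \<theta> \<phi> = 1 / sin \<theta> *
     (deriv (\<lambda>t. F (sph t \<phi>)) \<theta> * deriv (\<lambda>s. G (sph \<theta> s)) \<phi>
    - deriv (\<lambda>s. F (sph \<theta> s)) \<phi> * deriv (\<lambda>t. G (sph t \<phi>)) \<theta>)"

text \<open>
  The coordinate formula is singular at the two poles; there the bracket is its
  continuous extension.
\<close>

definition poisson :: "(real^3 \<Rightarrow> real) \<Rightarrow> (real^3 \<Rightarrow> real) \<Rightarrow> real^3 \<Rightarrow> real" where
  "poisson F G p =
     (if sin (colat p) \<noteq> 0 then chart_bracket F G (colat p) (lon p)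
      else Lim (at p within S2) (\<lambda>q. chart_bracket F G (colat q) (lon q)))"

section \<open>Great circles\<close>

definition great_circle :: "(real^3) set \<Rightarrow> bool" where
  "great_circle C \<longleftrightarrow> (\<exists>n. n \<noteq> 0 \<and> C = S2 \<inter> {x. n \<bullet> x = 0})"

definition antipodal_pair :: "(real^3) set \<Rightarrow> bool" where
  "antipodal_pair P \<longleftrightarrow> (\<exists>p\<in>S2. P = {p, - p})"

definition sphere_dist :: "real^3 \<Rightarrow> real^3 \<Rightarrow> real" where
  "sphere_dist x y = arccos (x \<bullet> y)"

definition dual :: "(real^3) set \<Rightarrow> (real^3) set \<Rightarrow> bool" where
  "dual P C \<longleftrightarrow> antipodal_pair P \<and> great_circle C \<and>
     (\<forall>p\<in>P. \<forall>q\<in>P. \<forall>x\<in>C. sphere_dist x p = sphere_dist x q)"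

text \<open>For a great circle \<open>C\<close>, \<open>span C\<close> is the plane through the origin that contains it.\<close>

definition tangent_line :: "(real^3) set \<Rightarrow> real^3 \<Rightarrow> (real^3) set" where
  "tangent_line C p = {v \<in> span C. orthogonal v p}"

definition meet_orthogonally :: "(real^3) set \<Rightarrow> (real^3) set \<Rightarrow> bool" where
  "meet_orthogonally C D \<longleftrightarrow>
     (\<forall>p\<in>C \<inter> D. \<forall>v\<in>tangent_line C p. \<forall>w\<in>tangent_line D p. orthogonal v w)"

section \<open>Spherical triangles, given by their sets of vertices\<close>

definition spherical_triangle :: "(real^3) set \<Rightarrow> bool" where
  "spherical_triangle T \<longleftrightarrow> T \<subseteq> S2 \<and> card T = 3 \<and> independent T"

definition proper_triangle :: "(real^3) set \<Rightarrow> bool" where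
  "proper_triangle T \<longleftrightarrow> spherical_triangle T \<and>
     (\<forall>u\<in>T. \<forall>C P. great_circle C \<and> T - {u} \<subseteq> C \<and> dual P C \<longrightarrow> u \<notin> P)"

definition is_altitude :: "(real^3) set \<Rightarrow> real^3 \<Rightarrow> (real^3) set \<Rightarrow> bool" where
  "is_altitude T u A \<longleftrightarrow> great_circle A \<and> u \<in> A \<and>
     (\<exists>C. great_circle C \<and> T - {u} \<subseteq> C \<and> meet_orthogonally A C)"

text \<open>Existence and uniqueness for proper triangles: lemma \<open>is_altitude_altitude\<close> below.\<close>

definition altitude :: "(real^3) set \<Rightarrow> real^3 \<Rightarrow> (real^3) set" where
  "altitude T u = (THE A. is_altitude T u A)"

definition triangles_on ::
  "(real^3) set \<Rightarrow> (real^3) set \<Rightarrow> (real^3) set \<Rightarrow> (real^3) set set" where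
  "triangles_on P Q R = {{p, q, r} | p q r. p \<in> P \<and> q \<in> Q \<and> r \<in> R}"

definition triangles_of_circles ::
  "(real^3) set \<Rightarrow> (real^3) set \<Rightarrow> (real^3) set \<Rightarrow> (real^3) set set" where
  "triangles_of_circles A B C = triangles_on (B \<inter> C) (C \<inter> A) (A \<inter> B)"

section \<open>Well-definedness of the above notions\<close>

unbundle cross3_syntax

lemma v3: "(vector [x,y,z]::real^3) $ 1 = (x::real)" "(vector [x,y,z]::real^3) $ 2 = y" "(vector [x,y,z]::real^3) $ 3 = z"
  by simp_all

lemma sph_S2: "sph \<theta> \<phi> \<in> S2"
proof -
  have "(sin \<theta> * cos \<phi>)\<^sup>2 + (sin \<theta> * sin \<phi>)\<^sup>2 + (cos \<theta>)\<^sup>2 = (sin \<theta>)\<^sup>2 * ((sin \<phi>)\<^sup>2 + (cos \<phi>)\<^sup>2) + (cos \<theta>)\<^sup>2"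
    by (simp only: power_mult_distrib distrib_left add_ac)
  also have "\<dots> = 1" by simp
  finally show ?thesis by (simp add: sph_def norm_eq_1 inner_vec_def sum_3 power2_eq_square)
qed

lemma S2_eq: "p \<in> S2 \<Longrightarrow> (p$1)^2 + (p$2)^2 + (p$3)^2 = 1"
  by (simp add: norm_eq_1 inner_vec_def sum_3 power2_eq_square)

lemma sph_colat_lon: assumes "p \<in> S2" shows "sph (colat p) (lon p) = p"
proof -
  have s: "(p$1)^2 + (p$2)^2 + (p$3)^2 = 1" using S2_eq assms .
  then have "(p$3)^2 \<le> 1" by (smt (verit) zero_le_power2)
  then have b: "-1 \<le> p$3" "p$3 \<le> 1" by (auto simp: abs_square_le_1 abs_le_iff)
  have c: "cos (colat p) = p$3" using b by (simp add: colat_def)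
  have "sin (colat p) = sqrt (1 - (p$3)^2)" using b by (simp add: colat_def sin_arccos)
  then have r: "sin (colat p) = cmod (Complex (p$1) (p$2))" using s by (simp add: cmod_def)
  have "rcis (cmod (Complex (p$1) (p$2))) (lon p) = Complex (p$1) (p$2)" unfolding lon_def by (rule rcis_cmod_Arg)
  then have "sin (colat p) * cos (lon p) = p$1" "sin (colat p) * sin (lon p) = p$2"
    unfolding r by (auto simp: complex_eq_iff)
  with c show ?thesis by (simp add: sph_def vec_eq_iff forall_3)
qed

lemma lin_comb_S2: "p \<in> S2 \<Longrightarrow> lin_comb v p = v \<bullet> p"
  using arg_cong[OF sph_colat_lon, of p "\<lambda>x. v \<bullet> x"]
  by (simp add: lin_comb_def f1_def f2_def f3_def sph_def inner_vec_def sum_3)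

lemma normalized_eq: assumes "\<forall>p\<in>S2. F p = lin_comb v p" shows "normalized F = v /\<^sub>R norm v"
proof -
  have "w = v" if w: "\<forall>p\<in>S2. F p = lin_comb w p" for w
  proof -
    have "w \<bullet> p = v \<bullet> p" if "p \<in> S2" for p using assms w that lin_comb_S2 by metis
    then have "w \<bullet> axis i 1 = v \<bullet> axis i 1" for i by (simp add: norm_axis_1)
    then show ?thesis by (simp add: inner_axis vec_eq_iff)
  qed
  note u = this
  have "(THE v. \<forall>p\<in>S2. F p = lin_comb v p) = v"
    apply (rule the_equality) apply (rule assms) apply (erule u) done
  then show ?thesis by (simp add: normalized_def)
qed

abbreviation circ :: "real^3 \<Rightarrow> (real^3) set" where
  "circ n \<equiv> S2 \<inter> {x. n \<bullet> x = 0}"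

lemma normalize_in: "x \<noteq> 0 \<Longrightarrow> n \<bullet> x = 0 \<Longrightarrow> x /\<^sub>R norm x \<in> circ n"
  by simp

lemma in_span_circ: assumes "n \<bullet> x = 0" shows "x \<in> span (circ n)"
proof (cases "x = 0")
  case True then show ?thesis by (simp only: span_zero)
next
  case False
  have "x /\<^sub>R norm x \<in> span (circ n)"
    apply (rule span_base) apply (rule normalize_in) apply (rule False) apply (rule assms) done
  then have "norm x *\<^sub>R (x /\<^sub>R norm x) \<in> span (circ n)" by (rule span_scale)
  moreover have "norm x *\<^sub>R (x /\<^sub>R norm x) = x" using False by simp
  ultimately show ?thesis by (simp only:)
qed

lemma span_circ: "span (circ n) = {x. n \<bullet> x = 0}"
  apply (rule subset_antisym)
   apply (rule span_minimal)
    apply (rule Int_lower2)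
   apply (rule subspace_hyperplane)
  apply (rule subsetI)
  apply (rule in_span_circ)
  apply (simp only: mem_Collect_eq)
  done

lemma parallel_perp: assumes "m \<times> n = 0" "m \<noteq> 0" "m \<bullet> x = 0" shows "n \<bullet> x = 0"
proof -
  have "(x \<bullet> n) *\<^sub>R m - (x \<bullet> m) *\<^sub>R n = 0" using Lagrange[of x m n] assms by simp
  then show ?thesis using assms by (simp add: inner_commute)
qed

lemma circ_sub: assumes "m \<noteq> 0" "n \<noteq> 0" "circ m \<subseteq> circ n" shows "m \<times> n = 0"
proof -
  have "span (circ m) \<subseteq> span (circ n)" by (rule span_mono) fact
  then have "m \<times> (m \<times> n) \<in> {x. n \<bullet> x = 0}" unfolding span_circ using dot_cross_self(1)[of m "m \<times> n"] by blast
  then have "n \<bullet> (m \<times> (m \<times> n)) = 0" by simp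
  moreover have "n \<bullet> (m \<times> (m \<times> n)) = - ((m \<times> n) \<bullet> (m \<times> n))"
    by (simp add: cross3_simps)
  ultimately show ?thesis by simp
qed

lemma circ_eq: assumes "m \<noteq> 0" "n \<noteq> 0" shows "circ m = circ n \<longleftrightarrow> m \<times> n = 0"
proof
  assume "circ m = circ n" then show "m \<times> n = 0" using circ_sub assms by blast
next
  assume "m \<times> n = 0"
  moreover then have "n \<times> m = 0" by (metis cross_skew neg_0_equal_iff_equal)
  ultimately show "circ m = circ n" using parallel_perp assms by blast
qed

lemma circ_through: assumes "v \<times> w \<noteq> 0" "n \<noteq> 0" "v \<in> circ n" "w \<in> circ n"
  shows "circ n = circ (v \<times> w)"
proof -
  have "n \<times> (v \<times> w) = 0" using assms by (simp add: Lagrange)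
  then show ?thesis using assms circ_eq by simp
qed

lemma perp_dir: assumes "norm p = 1" "m \<bullet> p = 0" "m \<bullet> s = 0" "s \<bullet> p = 0"
  shows "(m \<bullet> m) *\<^sub>R s = (s \<bullet> (m \<times> p)) *\<^sub>R (m \<times> p)"
proof -
  have "(m \<times> p) \<times> s = - (s \<times> (m \<times> p))" by (rule cross_skew)
  also have "\<dots> = 0" using assms by (simp add: Lagrange inner_commute)
  finally have z: "(m \<times> p) \<times> s = 0" .
  have "(m \<times> p) \<times> ((m \<times> p) \<times> s) = ((m\<times>p) \<bullet> s) *\<^sub>R (m \<times> p) - ((m\<times>p) \<bullet> (m \<times> p)) *\<^sub>R s"
    by (rule Lagrange)
  moreover have "(m\<times>p) \<bullet> (m \<times> p) = m \<bullet> m"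
    using assms by (simp add: dot_cross norm_eq_1 inner_commute)
  ultimately show ?thesis using z by (simp add: inner_commute)
qed

lemma meet_orth: assumes "m \<noteq> 0" "n \<noteq> 0"
  shows "meet_orthogonally (circ m) (circ n) \<longleftrightarrow> m \<bullet> n = 0"
proof
  assume L: "meet_orthogonally (circ m) (circ n)"
  have "\<exists>x. x \<noteq> 0 \<and> m \<bullet> x = 0 \<and> n \<bullet> x = 0"
  proof (cases "m \<times> n = 0")
    case False then show ?thesis by (intro exI[of _ "m \<times> n"]) (simp add: dot_cross_self)
  next
    case True
    obtain x where "m \<times> x \<noteq> 0" using cross_basis_nonzero[OF assms(1)] by blast
    then show ?thesis using parallel_perp[OF True assms(1)]
      by (intro exI[of _ "m \<times> x"]) (simp add: dot_cross_self)
  qed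
  then obtain x where x: "x \<noteq> 0" "m \<bullet> x = 0" "n \<bullet> x = 0" by blast
  define p where "p = x /\<^sub>R norm x"
  have p: "norm p = 1" "m \<bullet> p = 0" "n \<bullet> p = 0" using x by (auto simp: p_def)
  have "m \<times> p \<in> tangent_line (circ m) p" "n \<times> p \<in> tangent_line (circ n) p"
    unfolding tangent_line_def span_circ by (auto simp: dot_cross_self orthogonal_def)
  moreover have "p \<in> circ m \<inter> circ n" using p by simp
  ultimately have "(m \<times> p) \<bullet> (n \<times> p) = 0"
    using L unfolding meet_orthogonally_def orthogonal_def by blast
  then have "(m \<bullet> n) * (p \<bullet> p) = 0" using p by (simp add: dot_cross inner_commute)
  then show "m \<bullet> n = 0" using p by auto
next
  assume mn: "m \<bullet> n = 0"
  show "meet_orthogonally (circ m) (circ n)"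
    unfolding meet_orthogonally_def tangent_line_def span_circ orthogonal_def
  proof clarsimp
    fix p s t assume a: "norm p = 1" "m \<bullet> p = 0" "n \<bullet> p = 0" "m \<bullet> s = 0" "s \<bullet> p = 0" "n \<bullet> t = 0" "t \<bullet> p = 0"
    have "(m \<times> p) \<bullet> (n \<times> p) = 0" using a mn by (simp add: dot_cross inner_commute)
    then have "((m \<bullet> m) *\<^sub>R s) \<bullet> ((n \<bullet> n) *\<^sub>R t) = 0"
      unfolding perp_dir[OF a(1,2,4,5)] perp_dir[OF a(1,3,6,7)] by simp
    then show "s \<bullet> t = 0" using assms by simp
  qed
qed

lemma great_circleE: assumes "great_circle C" obtains n where "n \<noteq> 0" "C = circ n"
  using assms unfolding great_circle_def by blast

lemma great_circleI: "n \<noteq> 0 \<Longrightarrow> great_circle (circ n)"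
  unfolding great_circle_def by blast

lemma dual_iff: assumes "norm p = 1" shows "dual {p, -p} C \<longleftrightarrow> C = circ p"
proof
  assume d: "dual {p,-p} C"
  then obtain n where n: "n \<noteq> 0" "C = circ n" unfolding dual_def great_circle_def by blast
  have "x \<bullet> p = 0" if "x \<in> C" for x
  proof -
    have "arccos (x \<bullet> p) = arccos (x \<bullet> (-p))"
      using d that unfolding dual_def sphere_dist_def by blast
    then have "arccos (x \<bullet> p) = arccos (- (x \<bullet> p))" by (simp only: inner_minus_right)
    moreover have "\<bar>x \<bullet> p\<bar> \<le> 1" using Cauchy_Schwarz_ineq2[of x p] assms that n by simp
    ultimately have "x \<bullet> p = - (x \<bullet> p)" by (subst (asm) arccos_eq_iff) auto
    then show ?thesis by simp
  qed
  then have "circ n \<subseteq> circ p" using n by (auto simp: inner_commute)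
  moreover have p0: "p \<noteq> 0" using assms by auto
  ultimately show "C = circ p" using circ_sub[OF n(1) p0] circ_eq[OF n(1) p0] n(2) by blast
next
  assume C: "C = circ p"
  have p0: "p \<noteq> 0" using assms by auto
  have "x \<bullet> p = 0" if "x \<in> C" for x using that C by (simp add: inner_commute)
  then have "\<forall>q\<in>{p,-p}. \<forall>q'\<in>{p,-p}. \<forall>x\<in>C. sphere_dist x q = sphere_dist x q'"
    unfolding sphere_dist_def by simp
  moreover have "p \<in> S2" using assms by simp
  ultimately show "dual {p,-p} C"
    using great_circleI[OF p0] C unfolding dual_def antipodal_pair_def by blast
qed

lemma dual_pairE: assumes "dual P C" obtains p where "norm p = 1" "P = {p,-p}" "C = circ p"
proof -
  obtain p where p: "p \<in> S2" "P = {p,-p}" using assms unfolding dual_def antipodal_pair_def by blast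
  then have "norm p = 1" by simp
  then show thesis using that p dual_iff assms by blast
qed

lemma triangle_iff: "spherical_triangle {u,v,w} \<longleftrightarrow> norm u = 1 \<and> norm v = 1 \<and> norm w = 1 \<and> u \<bullet> (v \<times> w) \<noteq> 0"
proof
  assume L: "spherical_triangle {u,v,w}"
  then have ind: "independent {u,v,w}" and c: "card {u,v,w} = 3" and n: "norm u = 1" "norm v = 1" "norm w = 1"
    unfolding spherical_triangle_def by auto
  have d: "u \<noteq> v" "u \<noteq> w" "v \<noteq> w" using c by (auto simp: card_insert_if split: if_splits)
  have u: "u \<notin> span {v,w}" using ind d by (auto simp: independent_insert)
  have w: "w \<notin> span {v}" using ind d independent_insert[of w "{v}"] independent_mono[of "{u,v,w}" "{w,v}"] by auto
  have N: "v \<times> w \<noteq> 0"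
  proof
    assume "v \<times> w = 0"
    then have "\<exists>c. w = c *\<^sub>R v" using n by (auto simp: cross_eq_0 collinear_lemma)
    then show False using w by (auto simp: span_singleton)
  qed
  have "u \<bullet> (v \<times> w) \<noteq> 0"
  proof
    assume z: "u \<bullet> (v \<times> w) = 0"
    let ?N = "v \<times> w"
    have nn: "?N \<bullet> ?N \<noteq> 0" using N by simp
    have e1: "?N \<times> (u \<times> ?N) = (?N \<bullet> ?N) *\<^sub>R u" using z by (simp add: Lagrange[of ?N u ?N] inner_commute)
    have s: "?N \<times> v \<in> span {v,w}" "?N \<times> w \<in> span {v,w}"
      unfolding cross_skew[of ?N] Lagrange by (intro span_neg span_diff span_scale; simp add: span_base)+
    have "?N \<times> (u \<times> ?N) = (u \<bullet> w) *\<^sub>R (?N \<times> v) - (u \<bullet> v) *\<^sub>R (?N \<times> w)"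
      by (simp add: Lagrange[of u] Cross3.right_diff_distrib cross_mult_right)
    then have "?N \<times> (u \<times> ?N) \<in> span {v,w}" using s by (auto intro!: span_diff span_scale)
    then have "inverse (?N \<bullet> ?N) *\<^sub>R ((?N \<bullet> ?N) *\<^sub>R u) \<in> span {v,w}" unfolding e1 by (rule span_scale)
    then show False using nn u by simp
  qed
  with n show "norm u = 1 \<and> norm v = 1 \<and> norm w = 1 \<and> u \<bullet> (v \<times> w) \<noteq> 0" by simp
next
  assume R: "norm u = 1 \<and> norm v = 1 \<and> norm w = 1 \<and> u \<bullet> (v \<times> w) \<noteq> 0"
  have d: "u \<noteq> v" "u \<noteq> w" "v \<noteq> w" using R by (auto simp: dot_cross_self)
  have N: "v \<times> w \<noteq> 0" using R by auto
  have "u \<notin> span {v,w}"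
  proof
    assume "u \<in> span {v,w}"
    moreover have "span {v,w} \<subseteq> {x. (v \<times> w) \<bullet> x = 0}"
      by (rule span_minimal[OF _ subspace_hyperplane]) (auto simp: dot_cross_self)
    ultimately show False using R by (auto simp: inner_commute)
  qed
  moreover have "v \<notin> span {w}"
    using N by (auto simp: span_singleton cross_mult_left)
  ultimately have "independent {u,v,w}" using d R by (auto simp: independent_insert)
  then show "spherical_triangle {u,v,w}" using R d unfolding spherical_triangle_def by auto
qed

lemma spherical_triangleE:
  assumes "spherical_triangle T" "u \<in> T"
  obtains v w where "T = {u,v,w}" "T - {u} = {v,w}"
proof -
  have "card (T - {u}) = 2" using assms unfolding spherical_triangle_def
    by (simp add: card_Diff_singleton card_ge_0_finite)
  then obtain v w where "T - {u} = {v,w}" by (auto simp: card_2_iff)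
  then show thesis using that assms(2) by blast
qed

lemma proper_vertex:
  assumes "spherical_triangle T" "T = {u,v,w}" "T - {u} = {v,w}"
  shows "(\<forall>C P. great_circle C \<and> T - {u} \<subseteq> C \<and> dual P C \<longrightarrow> u \<notin> P) \<longleftrightarrow> u \<times> (v \<times> w) \<noteq> 0"
proof -
  have t: "norm u = 1" "norm v = 1" "norm w = 1" "u \<bullet> (v \<times> w) \<noteq> 0"
    using assms triangle_iff by auto
  then have N: "v \<times> w \<noteq> 0" by auto
  have vw: "v \<in> circ (v \<times> w)" "w \<in> circ (v \<times> w)" using t by (auto simp: dot_cross_self inner_commute)
  have u0: "u \<noteq> 0" using t by auto
  show ?thesis
  proof
    assume L: "\<forall>C P. great_circle C \<and> T - {u} \<subseteq> C \<and> dual P C \<longrightarrow> u \<notin> P"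
    show "u \<times> (v \<times> w) \<noteq> 0"
    proof
      assume "u \<times> (v \<times> w) = 0"
      then have e: "circ u = circ (v \<times> w)" using circ_eq u0 N by blast
      have "dual {u,-u} (circ u)" using dual_iff t by blast
      moreover have "T - {u} \<subseteq> circ u" using vw assms(3) e by auto
      ultimately have "u \<notin> {u,-u}" using L great_circleI[OF u0] by blast
      then show False by simp
    qed
  next
    assume R: "u \<times> (v \<times> w) \<noteq> 0"
    show "\<forall>C P. great_circle C \<and> T - {u} \<subseteq> C \<and> dual P C \<longrightarrow> u \<notin> P"
    proof (intro allI impI notI)
      fix C P assume a: "great_circle C \<and> T - {u} \<subseteq> C \<and> dual P C" and "u \<in> P"
      then obtain p where p: "norm p = 1" "P = {p,-p}" "C = circ p" using dual_pairE by metis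
      have p0: "p \<noteq> 0" using p by auto
      then have "circ p = circ (v \<times> w)" using circ_through[OF N] a assms(3) p by auto
      then have "p \<times> (v \<times> w) = 0" using circ_eq p0 N by blast
      then show False using R \<open>u \<in> P\<close> p by auto
    qed
  qed
qed

lemma is_altitude_iff:
  assumes "spherical_triangle T" "T = {u,v,w}" "T - {u} = {v,w}" and R: "u \<times> (v \<times> w) \<noteq> 0"
  shows "is_altitude T u A \<longleftrightarrow> A = circ (u \<times> (v \<times> w))"
proof -
  have t: "norm u = 1" "norm v = 1" "norm w = 1" "u \<bullet> (v \<times> w) \<noteq> 0"
    using assms triangle_iff by auto
  then have N: "v \<times> w \<noteq> 0" by auto
  have vw: "v \<in> circ (v \<times> w)" "w \<in> circ (v \<times> w)" using t by (auto simp: dot_cross_self inner_commute)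
  show ?thesis
  proof
    assume L: "is_altitude T u A"
    then obtain m where m: "m \<noteq> 0" "A = circ m" and um: "m \<bullet> u = 0"
      unfolding is_altitude_def great_circle_def by blast
    obtain C where C: "great_circle C" "T - {u} \<subseteq> C" "meet_orthogonally A C"
      using L unfolding is_altitude_def by blast
    obtain n where n: "n \<noteq> 0" "C = circ n" using C great_circleE by blast
    then have "C = circ (v \<times> w)" using circ_through[OF N] C assms(3) by auto
    then have "m \<bullet> (v \<times> w) = 0" using C m N meet_orth by blast
    then have "m \<times> (u \<times> (v \<times> w)) = 0" using um by (simp add: Lagrange[of m u])
    then show "A = circ (u \<times> (v \<times> w))" using circ_eq m R by blast
  next
    assume A: "A = circ (u \<times> (v \<times> w))"
    have "u \<in> A" using A t by (auto simp: dot_cross_self inner_commute)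
    moreover have "(u \<times> (v \<times> w)) \<bullet> (v \<times> w) = 0" by (simp add: dot_cross_self)
    then have "meet_orthogonally A (circ (v \<times> w))" using meet_orth[OF R N] A by simp
    moreover have "T - {u} \<subseteq> circ (v \<times> w)" using assms(3) vw by auto
    ultimately show "is_altitude T u A" unfolding is_altitude_def
      using great_circleI[OF N] great_circleI[OF R] A by blast
  qed
qed

lemma is_altitude_altitude:
  assumes "proper_triangle T" "u \<in> T"
  shows "is_altitude T u A \<longleftrightarrow> A = altitude T u"
proof -
  have T: "spherical_triangle T" using assms unfolding proper_triangle_def by blast
  obtain v w where vw: "T = {u,v,w}" "T - {u} = {v,w}" using spherical_triangleE T assms(2) by metis
  have "u \<times> (v \<times> w) \<noteq> 0" using proper_vertex[OF T vw] assms unfolding proper_triangle_def by blast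
  note i = is_altitude_iff[OF T vw this]
  show ?thesis unfolding altitude_def i by simp
qed

unbundle no cross3_syntax

end

theory Submission
  imports Defs
begin

text \<open>
  An element of \<^const>\<open>S1\<close> is, on the sphere, \<open>p \<mapsto> v \<bullet> p\<close> for a vector \<open>v\<close>, and under this
  identification the Poisson bracket becomes the cross product (\<open>poisson_eq_cross\<close>). The Jacobi
  identity for the bracket is therefore the one for the cross product: the vectors
  \<open>l = p \<times> (q \<times> r)\<close>, \<open>m = q \<times> (r \<times> p)\<close>, \<open>n = r \<times> (p \<times> q)\<close> satisfy \<open>l + m + n = 0\<close>.
  Normalizing \<open>p\<close>, \<open>q\<close>, \<open>r\<close> only multiplies all three terms by the same positive factor.

  Great circles correspond to their normals, and the altitude from \<open>p\<close> in the triangle \<open>p, q, r\<close>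
  is the circle with normal \<open>l\<close>: it passes through \<open>p\<close> because \<open>l\<close> is orthogonal to \<open>p\<close>, and it is
  perpendicular to the opposite side because \<open>l\<close> is orthogonal to \<open>q \<times> r\<close>, the normal of that
  side. So the Jacobi identity says that the normals of the three altitudes are linearly dependent:
  the third altitude contains the points common to the first two. For a proper triangle \<open>l\<close> and \<open>m\<close>
  are not parallel (\<open>altitude_normals_not_parallel\<close>), so these points form a single antipodal pair
  (\<open>altitude_circles_concurrent\<close>).

  Everything else is invariance of the normals \<open>l\<close>, \<open>m\<close>, \<open>n\<close> up to a common nonzero factor
  (\<open>proper_triangle_of_multiples\<close>). Replacing a vertex by its antipode multiplies them by \<open>-1\<close>,
  which settles the eight triangles with vertices \<open>\<plusminus>p, \<plusminus>q, \<plusminus>r\<close>. The circles dual to the vertices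
  intersect in the multiples of \<open>q \<times> r\<close>, \<open>r \<times> p\<close>, \<open>p \<times> q\<close>, and the vertices of this polar triangle
  have, since \<open>(r \<times> p) \<times> (p \<times> q) = (p \<bullet> (q \<times> r)) p\<close>, the same normals up to a factor
  (\<open>polar_triangle\<close>): an altitude is perpendicular both to a side and to the polar of the
  opposite vertex, which is a side of the polar triangle.
\<close>

section \<open>The Poisson bracket as a cross product\<close>

unbundle cross3_syntax

text \<open>
  The bracket is the area form evaluated on the tangential gradients: the coordinate vector fields
  \<open>e\<close>, \<open>f\<close> of \<open>\<theta>\<close>, \<open>\<phi>\<close> satisfy \<open>e \<times> f = sin \<theta> \<cdot> p\<close> at the point \<open>p\<close>, so the factor
  \<open>1 / sin \<theta>\<close> turns the Jacobian determinant into \<open>(v \<times> w) \<bullet> p\<close> by the Binet-Cauchy identity.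
\<close>

lemma chart_bracket_eq_cross:
  assumes F: "\<forall>p\<in>S2. F p = v \<bullet> p" and G: "\<forall>p\<in>S2. G p = w \<bullet> p" and s: "sin \<theta> \<noteq> 0"
  shows "chart_bracket F G \<theta> \<phi> = (v \<times> w) \<bullet> sph \<theta> \<phi>"
proof -
  define e where "e = (vector [cos \<theta> * cos \<phi>, cos \<theta> * sin \<phi>, - sin \<theta>] :: real^3)"
  define f where "f = (vector [- (sin \<theta> * sin \<phi>), sin \<theta> * cos \<phi>, 0] :: real^3)"
  have d: "deriv (\<lambda>t. H (sph t \<phi>)) \<theta> = u \<bullet> e" "deriv (\<lambda>t. H (sph \<theta> t)) \<phi> = u \<bullet> f"
    if "\<forall>p\<in>S2. H p = u \<bullet> p" for H u
  proof -
    have "H (sph a b) = u$1 * (sin a * cos b) + u$2 * (sin a * sin b) + u$3 * cos a" for a b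
      using that sph_S2[of a b] by (simp add: sph_def inner_vec_def sum_3)
    then show "deriv (\<lambda>t. H (sph t \<phi>)) \<theta> = u \<bullet> e" "deriv (\<lambda>t. H (sph \<theta> t)) \<phi> = u \<bullet> f"
      by (auto intro!: DERIV_imp_deriv derivative_eq_intros simp: e_def f_def inner_vec_def sum_3)
  qed
  have "e \<times> f = sin \<theta> *\<^sub>R sph \<theta> \<phi>"
  proof -
    have "cos \<theta> * cos \<phi> * (sin \<theta> * cos \<phi>) + cos \<theta> * sin \<phi> * (sin \<theta> * sin \<phi>)
        = sin \<theta> * cos \<theta> * ((cos \<phi>)\<^sup>2 + (sin \<phi>)\<^sup>2)"
      by (simp only: power2_eq_square distrib_left mult_ac)
    then show ?thesis
      by (simp add: e_def f_def sph_def cross3_def vec_eq_iff forall_3)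
  qed
  then have "(v \<bullet> e) * (w \<bullet> f) - (v \<bullet> f) * (w \<bullet> e) = sin \<theta> * ((v \<times> w) \<bullet> sph \<theta> \<phi>)"
    using dot_cross[of v w e f] by (simp add: inner_commute)
  then show ?thesis using s by (simp add: chart_bracket_def d[OF F] d[OF G])
qed

text \<open>
  Away from the poles this is the chart computation. At a pole it extends by continuity, as the
  chart formula agrees with the continuous function \<open>q \<mapsto> (v \<times> w) \<bullet> q\<close> at all other points but
  the opposite pole.
\<close>

lemma poisson_eq_cross:
  assumes F: "\<forall>p\<in>S2. F p = v \<bullet> p" and G: "\<forall>p\<in>S2. G p = w \<bullet> p"
  shows "\<forall>p\<in>S2. poisson F G p = (v \<times> w) \<bullet> p"
proof
  fix p :: "real^3"
  assume p: "p \<in> S2"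
  have off: "chart_bracket F G (colat q) (lon q) = (v \<times> w) \<bullet> q"
    if "q \<in> S2" "sin (colat q) \<noteq> 0" for q
    using chart_bracket_eq_cross[OF F G that(2), of "lon q"] sph_colat_lon[OF that(1)] by simp
  show "poisson F G p = (v \<times> w) \<bullet> p"
  proof (cases "sin (colat p) = 0")
    case False
    then show ?thesis using off p by (simp add: poisson_def)
  next
    case True
    have pole: "q = axis 3 1 \<or> q = - axis 3 1" if "q \<in> S2" "sin (colat q) = 0" for q :: "real^3"
    proof -
      have q: "q$1 = 0" "q$2 = 0"
        using arg_cong[OF sph_colat_lon[OF that(1)], of "\<lambda>x. x$1"]
          arg_cong[OF sph_colat_lon[OF that(1)], of "\<lambda>x. x$2"] that(2)
        by (simp_all add: sph_def)
      then have "q$3 = 1 \<or> q$3 = -1" using S2_eq[OF that(1)] by (simp add: power2_eq_1_iff)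
      with q show ?thesis by (auto simp: vec_eq_iff forall_3 axis_def)
    qed
    have p0: "p \<noteq> - p" using p by (auto simp: eq_neg_iff_add_eq_0 simp flip: scaleR_2)
    \<comment> \<open>Close to one pole the other one is excluded, so that the chart is regular there.\<close>
    have "\<forall>\<^sub>F q in at p within S2. q \<noteq> - p"
      using p0 by (intro tendsto_imp_eventually_ne[OF tendsto_ident_at])
    moreover have "\<forall>\<^sub>F q in at p within S2. q \<in> S2 \<and> q \<noteq> p"
      by (simp add: eventually_at_filter)
    ultimately have "\<forall>\<^sub>F q in at p within S2. (v \<times> w) \<bullet> q = chart_bracket F G (colat q) (lon q)"
    proof eventually_elim
      case (elim q)
      then have "sin (colat q) \<noteq> 0" using pole[of q] pole[OF p True] by auto
      with elim show ?case using off by simp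
    qed
    moreover have "((\<lambda>q. (v \<times> w) \<bullet> q) \<longlongrightarrow> (v \<times> w) \<bullet> p) (at p within S2)"
      by (intro tendsto_intros)
    ultimately have "((\<lambda>q. chart_bracket F G (colat q) (lon q)) \<longlongrightarrow> (v \<times> w) \<bullet> p) (at p within S2)"
      by (rule Lim_transform_eventually[rotated])
    \<comment> \<open>The sphere has no isolated point; hence the limit at the pole is unique.\<close>
    moreover have "at p within S2 \<noteq> bot"
    proof -
      have "connected S2" by (rule connected_sphere) simp
      then have "p islimpt S2"
        using connected_imp_perfect p p0
        by (smt (verit, best) dist_0_norm mem_sphere norm_minus_cancel singletonD)
      then show ?thesis by (simp add: trivial_limit_within)
    qed
    ultimately show ?thesis using True by (simp add: poisson_def tendsto_Lim)
  qed
qed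

lemma poisson_Jacobi:
  assumes "F \<in> S1" "G \<in> S1" "H \<in> S1" "p \<in> S2"
  shows "poisson (poisson F G) H p + poisson (poisson G H) F p + poisson (poisson H F) G p = 0"
proof -
  obtain u v w where F: "\<forall>p\<in>S2. F p = u \<bullet> p" and G: "\<forall>p\<in>S2. G p = v \<bullet> p"
    and H: "\<forall>p\<in>S2. H p = w \<bullet> p"
    using assms(1-3) lin_comb_S2 unfolding S1_def by (auto simp only: mem_Collect_eq) metis
  note b = poisson_eq_cross
  have "poisson (poisson F G) H p + poisson (poisson G H) F p + poisson (poisson H F) G p
      = ((u \<times> v) \<times> w + (v \<times> w) \<times> u + (w \<times> u) \<times> v) \<bullet> p"
    using b[OF b[OF F G] H] b[OF b[OF G H] F] b[OF b[OF H F] G] assms(4)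
    by (simp add: inner_add_left)
  also have "(u \<times> v) \<times> w + (v \<times> w) \<times> u + (w \<times> u) \<times> v = - (w \<times> (u \<times> v) + u \<times> (v \<times> w) + v \<times> (w \<times> u))"
    using cross_skew[of "u \<times> v" w] cross_skew[of "v \<times> w" u] cross_skew[of "w \<times> u" v] by simp
  also have "\<dots> = 0" using Jacobi[of w u v] by simp
  finally show ?thesis by simp
qed

section \<open>Altitudes and their normals\<close>

lemma circ_scaleR:
  assumes "c \<noteq> 0" shows "circ (c *\<^sub>R n) = circ n"
  using assms by auto

text \<open>
  A vector orthogonal to both \<open>m\<close> and \<open>n\<close> is a multiple of \<open>m \<times> n\<close>. This locates the orthocentres
  as well as the vertices cut out by three great circles.
\<close>

lemma circ_Int:
  assumes "m \<times> n \<noteq> 0"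
  defines "h \<equiv> (m \<times> n) /\<^sub>R norm (m \<times> n)"
  shows "circ m \<inter> circ n = {h, - h}"
proof
  have "norm h = 1" "m \<bullet> h = 0" "n \<bullet> h = 0"
    using assms by (simp_all add: dot_cross_self)
  then show "{h, - h} \<subseteq> circ m \<inter> circ n" by simp
next
  show "circ m \<inter> circ n \<subseteq> {h, - h}"
  proof
    fix x assume x: "x \<in> circ m \<inter> circ n"
    then have "x \<times> (m \<times> n) = 0" by (simp add: Lagrange inner_commute)
    then have "x \<times> h = 0" by (simp add: h_def cross_mult_right)
    moreover have h: "norm h = 1" using assms by simp
    ultimately have "x = (x \<bullet> h) *\<^sub>R h"
      using Lagrange[of h x h] by (simp add: norm_eq_1 inner_commute)
    moreover from this have "\<bar>x \<bullet> h\<bar> = 1"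
      using x h by (metis IntD1 dist_0_norm mem_sphere mult.right_neutral norm_scaleR)
    ultimately show "x \<in> {h, - h}" by (auto simp: abs_if split: if_splits)
  qed
qed

lemma triple_rotate: "v \<bullet> (w \<times> u) = u \<bullet> (v \<times> w)"
  by (simp add: cross3_simps)

lemma proper_triangle_iff:
  "proper_triangle {u, v, w} \<longleftrightarrow> norm u = 1 \<and> norm v = 1 \<and> norm w = 1 \<and> u \<bullet> (v \<times> w) \<noteq> 0
     \<and> u \<times> (v \<times> w) \<noteq> 0 \<and> v \<times> (w \<times> u) \<noteq> 0 \<and> w \<times> (u \<times> v) \<noteq> 0"
proof (cases "spherical_triangle {u, v, w}")
  case True
  then have "u \<bullet> (v \<times> w) \<noteq> 0" by (simp add: triangle_iff)
  then have d: "u \<noteq> v" "u \<noteq> w" "v \<noteq> w" by (auto simp: dot_cross_self)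
  have "{u, v, w} - {u} = {v, w}" "{u, v, w} - {v} = {w, u}" "{u, v, w} - {w} = {u, v}"
    "{u, v, w} = {v, w, u}" "{u, v, w} = {w, u, v}"
    using d by auto
  then show ?thesis
    using True proper_vertex[OF True, of u v w] proper_vertex[OF True, of v w u]
      proper_vertex[OF True, of w u v]
    unfolding proper_triangle_def triangle_iff by blast
next
  case False
  then show ?thesis unfolding proper_triangle_def triangle_iff by blast
qed

lemma altitude_eq_circ:
  assumes "proper_triangle {u, v, w}"
  shows "altitude {u, v, w} u = circ (u \<times> (v \<times> w))"
proof -
  have "spherical_triangle {u, v, w}" "u \<times> (v \<times> w) \<noteq> 0" "u \<bullet> (v \<times> w) \<noteq> 0"
    using assms proper_triangle_iff[of u v w] by (auto simp: triangle_iff)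
  moreover from this have "{u, v, w} - {u} = {v, w}" by (auto simp: dot_cross_self)
  ultimately show ?thesis
    using is_altitude_altitude[OF assms, of u] is_altitude_iff[of "{u, v, w}" u v w] by auto
qed

text \<open>
  The altitudes are recorded through their normals because in this form they can be compared
  between different triangles, with no reference to which vertex an altitude belongs to.
\<close>

definition altitude_circles :: "real^3 \<Rightarrow> real^3 \<Rightarrow> real^3 \<Rightarrow> (real^3) set set" where
  "altitude_circles u v w = {circ (u \<times> (v \<times> w)), circ (v \<times> (w \<times> u)), circ (w \<times> (u \<times> v))}"

lemma altitudes_eq_altitude_circles:
  assumes "proper_triangle {u, v, w}"
  shows "altitude {u, v, w} ` {u, v, w} = altitude_circles u v w"
proof -
  have "{v, w, u} = {u, v, w}" "{w, u, v} = {u, v, w}" by auto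
  then show ?thesis
    using altitude_eq_circ[of u v w] altitude_eq_circ[of v w u] altitude_eq_circ[of w u v] assms
    by (simp add: altitude_circles_def)
qed

text \<open>
  Great circles see their normals only up to a factor, and so does the nonvanishing in
  \<open>proper_triangle_iff\<close>. Both the change of a vertex into its antipode and the passage to the polar
  triangle are of this kind, with \<open>k = \<plusminus>1\<close> and \<open>k\<close> a nonzero multiple of
  \<open>p \<bullet> (q \<times> r)\<close> respectively.
\<close>

lemma proper_triangle_of_multiples:
  assumes "norm u = 1" "norm v = 1" "norm w = 1"
    and "u \<bullet> (v \<times> w) \<noteq> 0"
    and "k \<noteq> 0"
    and "u \<times> (v \<times> w) = k *\<^sub>R (p \<times> (q \<times> r))"
    and "v \<times> (w \<times> u) = k *\<^sub>R (q \<times> (r \<times> p))"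
    and "w \<times> (u \<times> v) = k *\<^sub>R (r \<times> (p \<times> q))"
    and "proper_triangle {p, q, r}"
  shows "proper_triangle {u, v, w}" "altitude_circles u v w = altitude_circles p q r"
  using assms by (simp_all only: proper_triangle_iff altitude_circles_def circ_scaleR scaleR_eq_0_iff) auto

section \<open>The eight triangles on three antipodal pairs\<close>

lemma triangles_on_antipodes:
  assumes pr: "proper_triangle {p, q, r}" and T: "T \<in> triangles_on {p, - p} {q, - q} {r, - r}"
  shows "proper_triangle T" "altitude T ` T = altitude_circles p q r"
proof -
  obtain u v w where T: "T = {u, v, w}"
    and m: "u \<in> {p, - p}" "v \<in> {q, - q}" "w \<in> {r, - r}"
    using T unfolding triangles_on_def by blast
  have *: "\<exists>s::real. (s = 1 \<or> s = -1) \<and> x = s *\<^sub>R y" if "x \<in> {y, - y}" for x y :: "real^3"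
    using that by force
  obtain a b c :: real where s: "a = 1 \<or> a = -1" "b = 1 \<or> b = -1" "c = 1 \<or> c = -1"
    and e: "u = a *\<^sub>R p" "v = b *\<^sub>R q" "w = c *\<^sub>R r"
    using *[OF m(1)] *[OF m(2)] *[OF m(3)] by blast
  have n: "a * b * c \<noteq> 0" using s by auto
  have "norm u = 1" "norm v = 1" "norm w = 1" "u \<bullet> (v \<times> w) \<noteq> 0"
    using s pr unfolding proper_triangle_iff e by (auto simp: cross_mult_left cross_mult_right)
  moreover have "u \<times> (v \<times> w) = (a * b * c) *\<^sub>R (p \<times> (q \<times> r))"
    "v \<times> (w \<times> u) = (a * b * c) *\<^sub>R (q \<times> (r \<times> p))"
    "w \<times> (u \<times> v) = (a * b * c) *\<^sub>R (r \<times> (p \<times> q))"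
    unfolding e by (simp_all add: cross_mult_left cross_mult_right mult_ac)
  ultimately have *: "proper_triangle {u, v, w}" "altitude_circles u v w = altitude_circles p q r"
    using proper_triangle_of_multiples[OF _ _ _ _ n _ _ _ pr, of u v w] by blast+
  show "proper_triangle T" using * T by simp
  show "altitude T ` T = altitude_circles p q r"
    using altitudes_eq_altitude_circles[OF *(1)] * T by simp
qed

text \<open>
  Disjointness lets each vertex be recovered from the set of vertices, as the only one lying in
  \<open>P\<close>, in \<open>Q\<close> or in \<open>R\<close>.
\<close>

lemma card_triangles_on:
  assumes "P \<inter> Q = {}" "Q \<inter> R = {}" "R \<inter> P = {}"
  shows "card (triangles_on P Q R) = card P * (card Q * card R)"
proof -
  let ?f = "\<lambda>(p, q, r). {p, q, r}"
  have "inj_on ?f (Sigma P (\<lambda>_. Sigma Q (\<lambda>_. R)))"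
  proof (rule inj_onI)
    fix x x' assume x: "x \<in> Sigma P (\<lambda>_. Sigma Q (\<lambda>_. R))" "x' \<in> Sigma P (\<lambda>_. Sigma Q (\<lambda>_. R))" "?f x = ?f x'"
    obtain p q r p' q' r' where xx: "x = (p, q, r)" "x' = (p', q', r')"
      by (metis prod_cases3)
    have m: "p \<in> P" "q \<in> Q" "r \<in> R" "p' \<in> P" "q' \<in> Q" "r' \<in> R"
      and e: "{p, q, r} = {p', q', r'}"
      using x xx by auto
    have "{p} = {p, q, r} \<inter> P" "{p'} = {p', q', r'} \<inter> P"
      "{q} = {p, q, r} \<inter> Q" "{q'} = {p', q', r'} \<inter> Q"
      "{r} = {p, q, r} \<inter> R" "{r'} = {p', q', r'} \<inter> R"
      using m assms by auto
    with e show "x = x'" unfolding xx by (metis singleton_inject)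
  qed
  moreover have "triangles_on P Q R = ?f ` (Sigma P (\<lambda>_. Sigma Q (\<lambda>_. R)))"
    unfolding triangles_on_def by force
  ultimately show ?thesis by (simp add: card_image card_cartesian_product)
qed

lemma card_triangles_on_antipodes:
  assumes "spherical_triangle {p, q, r}"
  shows "card (triangles_on {p, - p} {q, - q} {r, - r}) = 8"
proof -
  have t: "norm p = 1" "norm q = 1" "norm r = 1" "p \<bullet> (q \<times> r) \<noteq> 0"
    using assms by (auto simp: triangle_iff)
  then have "{p, - p} \<inter> {q, - q} = {}" "{q, - q} \<inter> {r, - r} = {}" "{r, - r} \<inter> {p, - p} = {}"
    by (auto simp: dot_cross_self)
  moreover have "card {x, - x} = 2" if "norm x = 1" for x :: "real^3"
  proof -
    have "x \<noteq> - x" using that by (auto simp: eq_neg_iff_add_eq_0 simp flip: scaleR_2)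
    then show ?thesis by simp
  qed
  ultimately show ?thesis using t by (simp add: card_triangles_on)
qed

section \<open>Concurrence of the altitudes\<close>

lemma cross_altitude_normals:
  "(p \<times> (q \<times> r)) \<times> (q \<times> (r \<times> p))
     = ((p \<bullet> r) * (p \<bullet> q)) *\<^sub>R (q \<times> r) + ((p \<bullet> q) * (q \<bullet> r)) *\<^sub>R (r \<times> p)
       + ((q \<bullet> r) * (p \<bullet> r)) *\<^sub>R (p \<times> q)"
  unfolding Lagrange
  by (simp add: Cross3.left_diff_distrib Cross3.right_diff_distrib cross_mult_left cross_mult_right
      cross_skew[of q p] cross_skew[of p r] cross_skew[of r q] inner_commute algebra_simps)

text \<open>
  Since \<open>q \<times> r\<close>, \<open>r \<times> p\<close>, \<open>p \<times> q\<close> form a basis, \<open>cross_altitude_normals\<close> can vanish only if two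
  of the three cosines \<open>p \<bullet> q\<close>, \<open>q \<bullet> r\<close>, \<open>r \<bullet> p\<close> do. But then the vertex common to these two cosines
  is orthogonal to the other two vertices, which properness forbids.
\<close>

lemma altitude_normals_not_parallel:
  assumes "proper_triangle {p, q, r}"
  shows "(p \<times> (q \<times> r)) \<times> (q \<times> (r \<times> p)) \<noteq> 0" (is "?h \<noteq> 0")
proof
  assume z: "?h = 0"
  have pr: "p \<bullet> (q \<times> r) \<noteq> 0" "p \<times> (q \<times> r) \<noteq> 0" "q \<times> (r \<times> p) \<noteq> 0" "r \<times> (p \<times> q) \<noteq> 0"
    using assms by (auto simp: proper_triangle_iff)
  have "p \<bullet> ?h = (p \<bullet> r) * (p \<bullet> q) * (p \<bullet> (q \<times> r))"
    "q \<bullet> ?h = (p \<bullet> q) * (q \<bullet> r) * (p \<bullet> (q \<times> r))"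
    "r \<bullet> ?h = (q \<bullet> r) * (p \<bullet> r) * (p \<bullet> (q \<times> r))"
    unfolding cross_altitude_normals
    using triple_rotate[of q r p] triple_rotate[of r p q]
    by (simp_all add: inner_add_right dot_cross_self)
  then have "(p \<bullet> r) * (p \<bullet> q) = 0" "(p \<bullet> q) * (q \<bullet> r) = 0" "(q \<bullet> r) * (p \<bullet> r) = 0"
    using z pr(1) by auto
  then show False using pr(2-4) unfolding Lagrange by (auto simp: inner_commute)
qed

text \<open>
  The Jacobi identity expresses the normal \<open>n\<close> of the third altitude by those of the other two, so
  the third altitude passes through the two points in which the first two intersect.
\<close>

lemma altitude_circles_concurrent:
  assumes "proper_triangle {p, q, r}"
  shows "\<exists>h\<in>S2. \<Inter>(altitude_circles p q r) = {h, - h}"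
proof -
  define l where "l = p \<times> (q \<times> r)"
  define m where "m = q \<times> (r \<times> p)"
  define n where "n = r \<times> (p \<times> q)"
  define h where "h = (l \<times> m) /\<^sub>R norm (l \<times> m)"
  have "l + m + n = 0" unfolding l_def m_def n_def by (rule Jacobi)
  then have "n = - (l + m)" by (simp only: add_eq_0_iff)
  then have "circ l \<inter> circ m \<subseteq> circ n" by (auto simp: inner_add_left inner_diff_left)
  moreover have lm: "l \<times> m \<noteq> 0"
    unfolding l_def m_def using altitude_normals_not_parallel[OF assms] .
  moreover have "circ l \<inter> circ m = {h, - h}" unfolding h_def by (rule circ_Int[OF lm])
  moreover have "altitude_circles p q r = {circ l, circ m, circ n}"
    by (simp add: altitude_circles_def l_def m_def n_def)
  moreover have "h \<in> S2" using lm by (simp add: h_def)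
  ultimately show ?thesis by (intro bexI[of _ h]) auto
qed

section \<open>The polar triangle\<close>

lemma cross_cross_common: "(r \<times> p) \<times> (p \<times> q) = (p \<bullet> (q \<times> r)) *\<^sub>R p"
  by (simp add: Lagrange[of "r \<times> p"] dot_cross_self triple_rotate[of q r p] inner_commute[of "r \<times> p"])

text \<open>
  Since \<open>v \<times> w\<close> is a multiple of \<open>p\<close> and \<open>u\<close> one of \<open>q \<times> r\<close>, the altitude normal \<open>u \<times> (v \<times> w)\<close> is
  a multiple of \<open>(q \<times> r) \<times> p = - p \<times> (q \<times> r)\<close>; the factor is the same for all three vertices.
\<close>

lemma polar_triangle:
  assumes pr: "proper_triangle {p, q, r}"
  obtains u v w where "circ q \<inter> circ r = {u, - u}" "circ r \<inter> circ p = {v, - v}"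
    "circ p \<inter> circ q = {w, - w}" "proper_triangle {u, v, w}"
    "altitude_circles u v w = altitude_circles p q r"
proof -
  define D where "D = p \<bullet> (q \<times> r)"
  have D: "D \<noteq> 0" "D = q \<bullet> (r \<times> p)" "D = r \<bullet> (p \<times> q)"
    using pr triple_rotate[of q r p] triple_rotate[of r p q]
    by (auto simp: proper_triangle_iff D_def)
  then have nz: "q \<times> r \<noteq> 0" "r \<times> p \<noteq> 0" "p \<times> q \<noteq> 0" by (auto simp: D_def)
  define a where "a = inverse (norm (q \<times> r))"
  define b where "b = inverse (norm (r \<times> p))"
  define c where "c = inverse (norm (p \<times> q))"
  define u where "u = a *\<^sub>R (q \<times> r)"
  define v where "v = b *\<^sub>R (r \<times> p)"
  define w where "w = c *\<^sub>R (p \<times> q)"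
  have k: "- (a * b * c * D) \<noteq> 0" using nz D by (simp add: a_def b_def c_def)
  have x: "v \<times> w = (b * c * D) *\<^sub>R p" "w \<times> u = (c * a * D) *\<^sub>R q" "u \<times> v = (a * b * D) *\<^sub>R r"
    using cross_cross_common[of r p q] cross_cross_common[of p q r] cross_cross_common[of q r p] D D_def
    by (simp_all add: u_def v_def w_def cross_mult_left cross_mult_right)
  have y: "u \<times> (v \<times> w) = - (a * b * c * D) *\<^sub>R (p \<times> (q \<times> r))"
    "v \<times> (w \<times> u) = - (a * b * c * D) *\<^sub>R (q \<times> (r \<times> p))"
    "w \<times> (u \<times> v) = - (a * b * c * D) *\<^sub>R (r \<times> (p \<times> q))"
    using cross_skew[of p "q \<times> r"] cross_skew[of q "r \<times> p"] cross_skew[of r "p \<times> q"]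
    unfolding x by (simp_all add: u_def v_def w_def cross_mult_left cross_mult_right mult_ac)
  have "norm u = 1" "norm v = 1" "norm w = 1"
    using nz by (simp_all add: u_def v_def w_def a_def b_def c_def)
  moreover have "u \<bullet> (v \<times> w) \<noteq> 0"
    unfolding x using k D(1) by (simp add: u_def inner_commute[of _ p] flip: D_def)
  ultimately have "proper_triangle {u, v, w}" "altitude_circles u v w = altitude_circles p q r"
    using proper_triangle_of_multiples[OF _ _ _ _ k y pr] by blast+
  moreover have "circ q \<inter> circ r = {u, - u}" "circ r \<inter> circ p = {v, - v}" "circ p \<inter> circ q = {w, - w}"
    using circ_Int nz unfolding u_def v_def w_def a_def b_def c_def by blast+
  ultimately show thesis by (intro that)
qed

lemma circ_Int3_empty:
  assumes "p \<bullet> (q \<times> r) \<noteq> 0"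
  shows "circ p \<inter> circ q \<inter> circ r = {}"
proof -
  have False if x: "x \<in> circ p \<inter> circ q \<inter> circ r" for x
  proof -
    have "x \<times> (q \<times> r) = 0" using x by (simp add: Lagrange inner_commute)
    then have e: "((q \<times> r) \<bullet> (q \<times> r)) *\<^sub>R x = (x \<bullet> (q \<times> r)) *\<^sub>R (q \<times> r)"
      using Lagrange[of "q \<times> r" x "q \<times> r"] by (simp add: inner_commute)
    from arg_cong[OF e, of "\<lambda>y. p \<bullet> y"]
    have "x \<bullet> (q \<times> r) = 0" using x assms by simp
    with e have "x = 0" using assms by auto
    with x show False by simp
  qed
  then show ?thesis by blast
qed

section \<open>The geometrical meaning of the Jacobi identity\<close>

unbundle no cross3_syntax

theorem proposition1p7:
  fixes F1 F2 F3 :: "real^3 \<Rightarrow> real"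
    and a1 a2 a3 :: "real^3"
    and \<alpha>1 \<alpha>2 \<alpha>3 :: "(real^3) set"
  assumes "F1 \<in> S1" "F2 \<in> S1" "F3 \<in> S1"
    and "\<exists>p\<in>S2. F1 p \<noteq> 0" "\<exists>p\<in>S2. F2 p \<noteq> 0" "\<exists>p\<in>S2. F3 p \<noteq> 0"
    and "a1 = normalized F1" "a2 = normalized F2" "a3 = normalized F3"
    and "proper_triangle {a1, a2, a3}"
    and "dual {a1, - a1} \<alpha>1" "dual {a2, - a2} \<alpha>2" "dual {a3, - a3} \<alpha>3"
  shows "(\<forall>p\<in>S2. poisson (poisson F1 F2) F3 p + poisson (poisson F2 F3) F1 p
             + poisson (poisson F3 F1) F2 p = 0)
    \<and> card (triangles_on {a1, - a1} {a2, - a2} {a3, - a3}) = 8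
    \<and> (\<exists>h\<in>S2. \<forall>T\<in>triangles_on {a1, - a1} {a2, - a2} {a3, - a3}.
          proper_triangle T \<and> (\<Inter>u\<in>T. altitude T u) = {h, - h})
    \<and> \<alpha>1 \<inter> \<alpha>2 \<inter> \<alpha>3 = {}
    \<and> card (triangles_of_circles \<alpha>1 \<alpha>2 \<alpha>3) = 8
    \<and> (\<forall>T'\<in>triangles_of_circles \<alpha>1 \<alpha>2 \<alpha>3. proper_triangle T' \<and>
          (\<forall>T\<in>triangles_on {a1, - a1} {a2, - a2} {a3, - a3}. altitude T' ` T' = altitude T ` T))"
proof -
  let ?\<Delta> = "triangles_on {a1, - a1} {a2, - a2} {a3, - a3}"
  let ?\<Delta>' = "triangles_of_circles \<alpha>1 \<alpha>2 \<alpha>3"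
  note pr = assms(10)
  have t: "spherical_triangle {a1, a2, a3}" using pr by (simp add: proper_triangle_def)
  then have n: "norm a1 = 1" "norm a2 = 1" "norm a3 = 1" by (simp_all add: triangle_iff)
  have \<alpha>: "\<alpha>1 = circ a1" "\<alpha>2 = circ a2" "\<alpha>3 = circ a3"
    using assms(11-13) n dual_iff by auto
  obtain u v w where uvw: "circ a2 \<inter> circ a3 = {u, - u}" "circ a3 \<inter> circ a1 = {v, - v}"
    "circ a1 \<inter> circ a2 = {w, - w}" and pr': "proper_triangle {u, v, w}"
    and same: "altitude_circles u v w = altitude_circles a1 a2 a3"
    using polar_triangle[OF pr] .
  have \<Delta>': "?\<Delta>' = triangles_on {u, - u} {v, - v} {w, - w}"
    unfolding triangles_of_circles_def \<alpha> uvw ..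
  obtain h where h: "h \<in> S2" "\<Inter>(altitude_circles a1 a2 a3) = {h, - h}"
    using altitude_circles_concurrent[OF pr] by blast
  have "\<forall>T\<in>?\<Delta>. proper_triangle T \<and> (\<Inter>u\<in>T. altitude T u) = {h, - h}"
    using triangles_on_antipodes[OF pr] h(2) by simp
  moreover have "\<alpha>1 \<inter> \<alpha>2 \<inter> \<alpha>3 = {}"
    unfolding \<alpha> using t by (intro circ_Int3_empty) (simp add: triangle_iff)
  moreover have "card ?\<Delta> = 8" "card ?\<Delta>' = 8"
    using card_triangles_on_antipodes t pr' unfolding \<Delta>' proper_triangle_def by blast+
  moreover have "\<forall>T'\<in>?\<Delta>'. proper_triangle T' \<and> (\<forall>T\<in>?\<Delta>. altitude T' ` T' = altitude T ` T)"
    unfolding \<Delta>' using triangles_on_antipodes[OF pr] triangles_on_antipodes[OF pr'] same by simp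
  ultimately show ?thesis
    using poisson_Jacobi[OF assms(1-3)] h(1) by blast
qed

end
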